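(* Let $\kappa_1=2\log_2\left(\frac{\sqrt5+1}{2}\right)-1$. Let $x$ be either the smallest or the greatest fixed point of the Minkowski question mark function $?$ in the open interval $(0,\frac12)$. Then there exist a positive integer $q_0$ and a real-valued function $E(q)$ of the positive integer $q$ with $E(q)=O(\log\log q)$ as $q\to\infty$ such that $$\left|x-\frac{p}{q}\right|>\frac{1}{\left(\frac{2\kappa_1}{\log 2}\log q+E(q)\right)q^2}$$ for all $q\in\mathbb{N}$ with $q>q_0$ and all $p\in\mathbb{N}$.
   Context: Here $\log$ is the natural logarithm and $\mathbb{N}$ is the set of positive integers. For positive integers $a_j$, $[a_1,a_2,\ldots]=\cfrac{1}{a_1+\cfrac{1}{a_2+\cdots}}$ denotes the (finite or infinite) continued fraction with zero integer part. The Minkowski question mark function $?:[0,1]\to[0,1]$ is defined by $?(0)=0$ and, for $x=[a_1,a_2,\ldots]\in(0,1]$, by $$?(x)=\sum_{k\ge 1}\frac{(-1)^{k+1}}{2^{a_1+\cdots+a_k-1}},$$ the sum being infinite if $x$ is irrational and finite (over all partial quotients) if $x$ is rational; the value does not depend on which of the two finite expansions of a rational number is used. The function $?$ is continuous and strictly increasing, with $?(0)=0$, $?(\frac12)=\frac12$, $?(1)=1$. A fixed point is a solution of $?(x)=x$. The smallest and the greatest fixed points in $(0,\frac12)$ exist (they might coincide). *)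

theory Defs
  imports Complex_Main "HOL-Library.Landau_Symbols"
begin

fun cfrac :: "nat list \<Rightarrow> real" where
  "cfrac [] = 0"
| "cfrac (a # as) = 1 / (real a + cfrac as)"

definition cfrac_finite :: "real \<Rightarrow> nat list \<Rightarrow> bool" where
  "cfrac_finite x as \<longleftrightarrow> (\<forall>a\<in>set as. a > 0) \<and> x = cfrac as"

definition cfrac_infinite :: "real \<Rightarrow> (nat \<Rightarrow> nat) \<Rightarrow> bool" where
  "cfrac_infinite x a \<longleftrightarrow> (\<forall>k. a k > 0) \<and> (\<lambda>n. cfrac (map a [0..<n])) \<longlonglongrightarrow> x"

text \<open>Partial quotients are indexed from 0, so the term with index \<open>k\<close> has sign \<open>(-1)^k\<close>.\<close>

definition qm_finite :: "nat list \<Rightarrow> real" where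
  "qm_finite as = (\<Sum>k<length as. (-1) ^ k / 2 ^ ((\<Sum>i\<le>k. as ! i) - 1))"

definition qm_infinite :: "(nat \<Rightarrow> nat) \<Rightarrow> real" where
  "qm_infinite a = (\<Sum>k. (-1) ^ k / 2 ^ ((\<Sum>i\<le>k. a i) - 1))"

definition qm_value :: "real \<Rightarrow> real \<Rightarrow> bool" where
  "qm_value x y \<longleftrightarrow>
     (\<exists>as. cfrac_finite x as \<and> y = qm_finite as) \<or>
     (\<exists>a. cfrac_infinite x a \<and> y = qm_infinite a)"

text \<open>Only the values on \<open>[0,1]\<close> are meaningful; there, \<open>qm_value x\<close> holds for
  exactly one number, see \<open>ex1_qm_value\<close> below.\<close>

definition question_mark :: "real \<Rightarrow> real" where
  "question_mark x = (if x = 0 then 0 else THE y. qm_value x y)"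

definition qm_fixed_points :: "real set" where
  "qm_fixed_points = {x \<in> {0<..<1/2}. question_mark x = x}"

definition kappa1 :: real where
  "kappa1 = 2 * log 2 ((sqrt 5 + 1) / 2) - 1"

lemma cfrac_bounds:
  assumes "\<forall>a\<in>set as. a > 0"
  shows "0 \<le> cfrac as \<and> cfrac as \<le> 1"
  using assms
proof (induction as)
  case (Cons a as)
  then have "real a \<ge> 1" "cfrac as \<ge> 0" by (auto simp: Suc_leI)
  then show ?case by (auto simp: divide_simps)
qed simp

lemma qm_term_Cons:
  fixes f :: "nat \<Rightarrow> nat"
  assumes "\<And>k. k < n \<Longrightarrow> f k > 0" and "a > 0" and "k < n"
  shows "(-1) ^ Suc k / 2 ^ ((a + (\<Sum>i\<le>k. f i)) - 1) =
         - (1 / 2 ^ a) * ((-1) ^ k / (2::real) ^ ((\<Sum>i\<le>k. f i) - 1))"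
proof -
  have "(\<Sum>i\<le>k. f i) \<ge> f 0" by (intro member_le_sum) auto
  moreover have "f 0 > 0" using assms by auto
  ultimately have "a + (\<Sum>i\<le>k. f i) - 1 = a + ((\<Sum>i\<le>k. f i) - 1)" by simp
  then show ?thesis by (simp only: power_add) simp
qed

lemma qm_finite_Nil [simp]: "qm_finite [] = 0"
  by (simp add: qm_finite_def)

lemma qm_finite_Cons:
  assumes "\<forall>x\<in>set (a # as). x > 0"
  shows "qm_finite (a # as) = (2 - qm_finite as) / 2 ^ a"
proof -
  have "qm_finite (a # as) = 1 / 2 ^ (a - 1) +
      (\<Sum>k<length as. (-1) ^ Suc k / 2 ^ ((a + (\<Sum>i\<le>k. as ! i)) - 1))"
    unfolding qm_finite_def by (simp add: sum.lessThan_Suc_shift sum.atMost_Suc_shift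
        del: sum.lessThan_Suc sum.atMost_Suc power_Suc)
  also have "(\<Sum>k<length as. (-1) ^ Suc k / 2 ^ ((a + (\<Sum>i\<le>k. as ! i)) - 1)) =
      (\<Sum>k<length as. - (1 / 2 ^ a) * ((-1) ^ k / (2::real) ^ ((\<Sum>i\<le>k. as ! i) - 1)))"
    using assms by (intro sum.cong refl qm_term_Cons[where n = "length as"]) auto
  also have "\<dots> = - qm_finite as / 2 ^ a"
    unfolding sum_distrib_left[symmetric] qm_finite_def by simp
  also have "1 / 2 ^ (a - 1) = (2::real) / 2 ^ a"
    using assms by (cases a) auto
  finally show ?thesis by (simp add: diff_divide_distrib)
qed

lemma qm_finite_bounds:
  assumes "\<forall>a\<in>set as. a > 0"
  shows "0 \<le> qm_finite as \<and> qm_finite as \<le> 1"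
  using assms
proof (induction as)
  case (Cons a as)
  then have "(2::real) ^ 1 \<le> 2 ^ a" by (intro power_increasing) auto
  with Cons show ?case by (auto simp: qm_finite_Cons divide_simps)
qed simp

lemma qm_infinite_sums:
  fixes a :: "nat \<Rightarrow> nat"
  assumes "\<forall>k. a k > 0"
  shows "(\<lambda>k. (-1) ^ k / 2 ^ ((\<Sum>i\<le>k. a i) - 1)) sums qm_infinite a"
proof -
  have "summable (\<lambda>k. (-1) ^ k / (2::real) ^ ((\<Sum>i\<le>k. a i) - 1))"
  proof (rule summable_comparison_test')
    show "summable (\<lambda>k. (1 / 2 :: real) ^ k)" by (simp add: summable_geometric)
    fix k :: nat
    have "(\<Sum>i\<le>k. 1) \<le> (\<Sum>i\<le>k. a i)" using assms by (intro sum_mono) (simp add: Suc_leI)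
    then have "(2::real) ^ k \<le> 2 ^ ((\<Sum>i\<le>k. a i) - 1)" by (intro power_increasing) auto
    then show "norm ((-1) ^ k / (2::real) ^ ((\<Sum>i\<le>k. a i) - 1)) \<le> (1 / 2) ^ k"
      by (simp add: norm_divide norm_power power_one_over divide_simps)
  qed
  then show ?thesis unfolding qm_infinite_def by (rule summable_sums)
qed

lemma qm_infinite_tendsto:
  assumes "\<forall>k. a k > 0"
  shows "(\<lambda>n. qm_finite (map a [0..<n])) \<longlonglongrightarrow> qm_infinite a"
proof -
  have "qm_finite (map a [0..<n]) = (\<Sum>k<n. (-1) ^ k / 2 ^ ((\<Sum>i\<le>k. a i) - 1))" for n
    unfolding qm_finite_def by (intro sum.cong refl) auto
  then show ?thesis using qm_infinite_sums[OF assms] by (simp add: sums_def)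
qed

lemma map_upt_Suc_shift: "map a [0..<Suc n] = a 0 # map (\<lambda>k. a (Suc k)) [0..<n]"
  by (simp add: map_upt_Suc del: upt_Suc)

lemma qm_value_bounds:
  assumes "qm_value x y"
  shows "0 \<le> x \<and> x \<le> 1 \<and> 0 \<le> y \<and> y \<le> 1"
proof -
  consider (fin) as where "cfrac_finite x as" "y = qm_finite as"
    | (inf) a where "cfrac_infinite x a" "y = qm_infinite a"
    using assms by (auto simp: qm_value_def)
  then show ?thesis
  proof cases
    case fin
    then show ?thesis using cfrac_bounds qm_finite_bounds by (auto simp: cfrac_finite_def)
  next
    case inf
    then have pos: "\<forall>k. a k > 0" and lim: "(\<lambda>n. cfrac (map a [0..<n])) \<longlonglongrightarrow> x"
      by (auto simp: cfrac_infinite_def)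
    note lim' = qm_infinite_tendsto[OF pos]
    have "\<forall>z\<in>set (map a [0..<n]). z > 0" for n using pos by auto
    from cfrac_bounds[OF this] qm_finite_bounds[OF this] show ?thesis
      using LIMSEQ_le_const[OF lim, of 0] LIMSEQ_le_const2[OF lim, of 1]
        LIMSEQ_le_const[OF lim', of 0] LIMSEQ_le_const2[OF lim', of 1] inf by auto
  qed
qed

text \<open>Splitting off the first partial quotient.\<close>

lemma qm_value_step:
  assumes "qm_value x y"
  shows "x = 0 \<and> y = 0 \<or>
    (\<exists>a t y'. a > 0 \<and> x = 1 / (real a + t) \<and> qm_value t y' \<and> y = (2 - y') / 2 ^ a)"
proof -
  consider (fin) as where "cfrac_finite x as" "y = qm_finite as"
    | (inf) a where "cfrac_infinite x a" "y = qm_infinite a"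
    using assms by (auto simp: qm_value_def)
  then show ?thesis
  proof cases
    case fin
    show ?thesis
    proof (cases as)
      case Nil
      then show ?thesis using fin by (simp add: cfrac_finite_def)
    next
      case (Cons a bs)
      have "qm_value (cfrac bs) (qm_finite bs)"
        using fin Cons by (auto simp: qm_value_def cfrac_finite_def)
      moreover have "y = (2 - qm_finite bs) / 2 ^ a"
        using fin Cons by (auto simp: cfrac_finite_def intro!: qm_finite_Cons)
      ultimately show ?thesis using fin Cons by (auto simp: cfrac_finite_def)
    qed
  next
    case inf
    define b where "b = (\<lambda>k. a (Suc k))"
    have pos: "\<forall>k. a k > 0" and lim: "(\<lambda>n. cfrac (map a [0..<n])) \<longlonglongrightarrow> x"
      using inf by (auto simp: cfrac_infinite_def)
    then have posb: "\<forall>k. b k > 0" by (simp add: b_def)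
    have lim1: "(\<lambda>n. cfrac (map a [0..<Suc n])) \<longlonglongrightarrow> x"
      using LIMSEQ_Suc[OF lim] .
    have map: "map a [0..<Suc n] = a 0 # map b [0..<n]" for n
      unfolding b_def by (rule map_upt_Suc_shift)
    have bnd: "0 \<le> cfrac (map b [0..<n]) \<and> cfrac (map b [0..<n]) \<le> 1" for n
      using posb by (intro cfrac_bounds) auto
    have a0: "real (a 0) > 0" using pos by simp
    have "cfrac (map a [0..<Suc n]) \<ge> 1 / (real (a 0) + 1)" for n
      unfolding map cfrac.simps using bnd[of n] a0 by (intro divide_left_mono) auto
    then have "x \<ge> 1 / (real (a 0) + 1)"
      by (intro LIMSEQ_le_const[OF lim1]) auto
    moreover have "1 / (real (a 0) + 1) > 0" by (simp add: add_pos_nonneg)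
    ultimately have x: "x > 0" by linarith
    define t where "t = 1 / x - real (a 0)"
    have "(\<lambda>n. 1 / cfrac (map a [0..<Suc n]) - real (a 0)) \<longlonglongrightarrow> t"
      unfolding t_def using x by (intro tendsto_intros lim1) auto
    moreover have "1 / cfrac (map a [0..<Suc n]) - real (a 0) = cfrac (map b [0..<n])" for n
      unfolding map by simp
    ultimately have "(\<lambda>n. cfrac (map b [0..<n])) \<longlonglongrightarrow> t" by simp
    then have "qm_value t (qm_infinite b)"
      using posb by (auto simp: qm_value_def cfrac_infinite_def)
    moreover have "x = 1 / (real (a 0) + t)" by (simp add: t_def)
    moreover have "y = (2 - qm_infinite b) / 2 ^ a 0"
    proof (rule LIMSEQ_unique)
      show "(\<lambda>n. qm_finite (map a [0..<Suc n])) \<longlonglongrightarrow> y"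
        using LIMSEQ_Suc[OF qm_infinite_tendsto[OF pos]] inf by simp
      have "qm_finite (map a [0..<Suc n]) = (2 - qm_finite (map b [0..<n])) / 2 ^ a 0" for n
        unfolding map using pos posb by (intro qm_finite_Cons) auto
      then show "(\<lambda>n. qm_finite (map a [0..<Suc n])) \<longlonglongrightarrow> (2 - qm_infinite b) / 2 ^ a 0"
        by (simp only:) (intro tendsto_intros qm_infinite_tendsto posb, simp)
    qed
    ultimately show ?thesis using pos by blast
  qed
qed

lemma qm_value_0:
  assumes "qm_value 0 y" shows "y = 0"
  using qm_value_step[OF assms]
proof
  assume "\<exists>a t y'. a > 0 \<and> 0 = 1 / (real a + t) \<and> qm_value t y' \<and> y = (2 - y') / 2 ^ a"
  then obtain a :: nat and t y' where "a > 0" "0 = 1 / (real a + t)" "qm_value t y'" by blast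
  with qm_value_bounds[of t y'] show ?thesis by auto
qed simp

lemma qm_value_1:
  assumes "qm_value 1 y" shows "y = 1"
proof -
  obtain a :: nat and t y' where *: "a > 0" "1 = 1 / (real a + t)" "qm_value t y'"
    "y = (2 - y') / 2 ^ a"
    using qm_value_step[OF assms] by auto
  have "t \<ge> 0" using qm_value_bounds[OF *(3)] by simp
  with * have "real a + t = 1" by (simp add: field_simps)
  with \<open>t \<ge> 0\<close> \<open>a > 0\<close> have "a = 1" "t = 0" by linarith+
  moreover from this * have "y' = 0" using qm_value_0 by blast
  ultimately show ?thesis using *(4) by simp
qed

lemma qm_value_close:
  assumes "qm_value x y" "qm_value x z"
  shows "\<bar>y - z\<bar> \<le> (1 / 2) ^ n"
  using assms
proof (induction n arbitrary: x y z)
  case 0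
  then show ?case using qm_value_bounds[of x y] qm_value_bounds[of x z] by auto
next
  case (Suc n)
  show ?case
  proof (cases "x = 0")
    case True
    then have "y = 0" "z = 0" using Suc.prems qm_value_0 by blast+
    then show ?thesis by simp
  next
    case False
    obtain a :: nat and s u where a: "a > 0" "x = 1 / (real a + s)" "qm_value s u" "y = (2 - u) / 2 ^ a"
      using qm_value_step[OF Suc.prems(1)] False by auto
    obtain b :: nat and t v where b: "b > 0" "x = 1 / (real b + t)" "qm_value t v" "z = (2 - v) / 2 ^ b"
      using qm_value_step[OF Suc.prems(2)] False by auto
    note bnds = qm_value_bounds[OF a(3)] qm_value_bounds[OF b(3)]
    have eq: "real a + s = real b + t"
      using a(2) b(2) False by (metis inverse_eq_divide inverse_inverse_eq)
    have cases: "a = b \<and> s = t \<or> b = Suc a \<and> s = 1 \<and> t = 0 \<or> a = Suc b \<and> s = 0 \<and> t = 1"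
    proof -
      have "real a \<le> real b + 1" "real b \<le> real a + 1" using eq bnds by linarith+
      then have "a = b \<or> b = Suc a \<or> a = Suc b" by linarith
      then show ?thesis using eq bnds by auto
    qed
    consider "a = b" "s = t" | "b = Suc a" "s = 1" "t = 0" | "a = Suc b" "s = 0" "t = 1"
      using cases by blast
    then show ?thesis
    proof cases
      case 1
      have "\<bar>u - v\<bar> \<le> (1 / 2) ^ n" using Suc.IH a b 1 by blast
      moreover have "y - z = (v - u) / 2 ^ a" using a b 1 by (simp add: field_simps)
      then have "\<bar>y - z\<bar> = \<bar>u - v\<bar> / 2 ^ a" by simp
      moreover have "(2::real) ^ 1 \<le> 2 ^ a" using a by (intro power_increasing) auto
      then have "\<bar>u - v\<bar> / 2 ^ a \<le> \<bar>u - v\<bar> / 2" by (intro divide_left_mono) auto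
      ultimately show ?thesis by simp
    next
      case 2
      then have "u = 1" "v = 0" using a b qm_value_0 qm_value_1 by auto
      then show ?thesis using a b 2 by simp
    next
      case 3
      then have "u = 0" "v = 1" using a b qm_value_0 qm_value_1 by auto
      then show ?thesis using a b 3 by simp
    qed
  qed
qed

lemma qm_value_unique:
  assumes "qm_value x y" "qm_value x z" shows "y = z"
proof (rule ccontr)
  assume "y \<noteq> z"
  then obtain n where "(1 / 2) ^ n < \<bar>y - z\<bar>"
    using real_arch_pow_inv[of "\<bar>y - z\<bar>" "1 / 2"] by auto
  with qm_value_close[OF assms, of n] show False by simp
qed

lemma cfrac_approx:
  fixes a :: "nat \<Rightarrow> nat" and X :: "nat \<Rightarrow> real"
  assumes pos: "\<And>n. a n > 0" and X: "\<And>n. 0 \<le> X n \<and> X n \<le> 1"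
    and step: "\<And>n. X n = 1 / (real (a n) + X (Suc n))"
  shows "\<bar>cfrac (map a [m..<m + n]) - X m\<bar> \<le> (1 / 4) ^ (n div 2)"
proof (induction n arbitrary: m rule: induct_nat_012)
  case 0
  then show ?case using X[of m] by simp
next
  case 1
  have "0 \<le> cfrac (map a [m..<m + 1]) \<and> cfrac (map a [m..<m + 1]) \<le> 1"
    using pos by (intro cfrac_bounds) auto
  then have "\<bar>cfrac (map a [m..<m + 1]) - X m\<bar> \<le> 1"
    using X[of m] unfolding abs_le_iff by linarith
  then show ?case by simp
next
  case (ge2 n)
  define A B c w where "A = real (a m)" "B = real (a (Suc m))"
    "c = cfrac (map a [Suc (Suc m)..<Suc (Suc m) + n])" "w = X (Suc (Suc m))"
  have AB: "A \<ge> 1" "B \<ge> 1" using pos[of m] pos[of "Suc m"] by (auto simp: A_B_c_w_def)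
  have c: "c \<ge> 0" using cfrac_bounds pos by (auto simp: A_B_c_w_def)
  have w: "w \<ge> 0" using X by (simp add: A_B_c_w_def)
  have "[m..<m + Suc (Suc n)] = m # Suc m # [Suc (Suc m)..<Suc (Suc m) + n]"
    by (simp add: upt_conv_Cons del: upt_Suc)
  then have "cfrac (map a [m..<m + Suc (Suc n)]) = 1 / (A + 1 / (B + c))"
    by (simp add: A_B_c_w_def del: upt_Suc)
  also have "\<dots> = (B + c) / (A * (B + c) + 1)" using AB c by (simp add: field_simps)
  finally have 1: "cfrac (map a [m..<m + Suc (Suc n)]) = (B + c) / (A * (B + c) + 1)" .
  have "X m = 1 / (A + 1 / (B + w))"
    using step[of m] step[of "Suc m"] by (simp add: A_B_c_w_def)
  also have "\<dots> = (B + w) / (A * (B + w) + 1)" using AB w by (simp add: field_simps)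
  finally have 2: "X m = (B + w) / (A * (B + w) + 1)" .
  have "1 * 1 \<le> A * (B + c)" "1 * 1 \<le> A * (B + w)"
    using AB c w by (intro mult_mono; simp)+
  then have D: "A * (B + c) + 1 \<ge> 2" "A * (B + w) + 1 \<ge> 2" by auto
  then have "2 * 2 \<le> (A * (B + c) + 1) * (A * (B + w) + 1)" by (intro mult_mono) auto
  moreover have "(B + c) / (A * (B + c) + 1) - (B + w) / (A * (B + w) + 1) =
      (c - w) / ((A * (B + c) + 1) * (A * (B + w) + 1))"
    using D by (subst diff_frac_eq) (auto simp: algebra_simps)
  ultimately have "\<bar>cfrac (map a [m..<m + Suc (Suc n)]) - X m\<bar> =
      \<bar>c - w\<bar> / ((A * (B + c) + 1) * (A * (B + w) + 1))" "4 \<le> (A * (B + c) + 1) * (A * (B + w) + 1)"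
    unfolding 1 2 using D by (simp_all add: abs_mult)
  then have "\<bar>cfrac (map a [m..<m + Suc (Suc n)]) - X m\<bar> \<le> \<bar>c - w\<bar> / 4"
    by (simp only:) (intro divide_left_mono; simp)
  also have "\<bar>c - w\<bar> \<le> (1 / 4) ^ (n div 2)" unfolding A_B_c_w_def by (rule ge2.IH)
  finally show ?case by simp
qed

lemma ex_qm_value:
  assumes x: "0 \<le> x" "x \<le> 1" shows "\<exists>y. qm_value x y"
proof -
  define g :: "real \<Rightarrow> real" where "g = (\<lambda>t. frac (1 / t))"
  have g: "0 \<le> g t \<and> g t \<le> 1" for t
    unfolding g_def using frac_lt_1[of "1 / t"] by (simp add: less_imp_le)
  have digit: "nat \<lfloor>1 / t\<rfloor> > 0 \<and> t = 1 / (real (nat \<lfloor>1 / t\<rfloor>) + g t)" if "0 < t" "t \<le> 1" for t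
  proof -
    have "\<lfloor>1 / t\<rfloor> \<ge> 1" using that by (simp add: le_floor_iff)
    then have "real (nat \<lfloor>1 / t\<rfloor>) = real_of_int \<lfloor>1 / t\<rfloor>" by (intro of_nat_nat) linarith
    then have "real (nat \<lfloor>1 / t\<rfloor>) + g t = 1 / t" by (simp add: g_def frac_def)
    with \<open>\<lfloor>1 / t\<rfloor> \<ge> 1\<close> show ?thesis by simp
  qed
  show ?thesis
  proof (cases "\<exists>n. (g ^^ n) x = 0")
    case True
    then obtain n where "(g ^^ n) x = 0" ..
    with x have "\<exists>as. cfrac_finite x as"
    proof (induction n arbitrary: x)
      case 0
      then have "cfrac_finite x []" by (simp add: cfrac_finite_def)
      then show ?case ..
    next
      case (Suc n)
      show ?case
      proof (cases "x = 0")
        case True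
        then have "cfrac_finite x []" by (simp add: cfrac_finite_def)
        then show ?thesis ..
      next
        case False
        have "(g ^^ n) (g x) = 0" using Suc.prems by (simp add: funpow_swap1)
        then obtain as where "cfrac_finite (g x) as" using Suc.IH g by blast
        then have "cfrac_finite x (nat \<lfloor>1 / x\<rfloor> # as)"
          using digit[of x] False Suc.prems unfolding cfrac_finite_def by auto
        then show ?thesis ..
      qed
    qed
    then show ?thesis by (auto simp: qm_value_def)
  next
    case False
    define X where "X = (\<lambda>n. (g ^^ n) x)"
    define a where "a = (\<lambda>n. nat \<lfloor>1 / X n\<rfloor>)"
    have "0 \<le> X n \<and> X n \<le> 1" for n using x g by (cases n) (auto simp: X_def)
    moreover have "X n \<noteq> 0" for n using False by (simp add: X_def)
    ultimately have X: "0 < X n \<and> X n \<le> 1" for n by (simp add: less_le)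
    have ap: "a n > 0 \<and> X n = 1 / (real (a n) + X (Suc n))" for n
    proof -
      have "X (Suc n) = g (X n)" by (simp add: X_def)
      then show ?thesis using digit[of "X n"] X[of n] unfolding a_def by metis
    qed
    have "(\<lambda>n. cfrac (map a [0..<n]) - X 0) \<longlonglongrightarrow> 0"
    proof (rule tendsto_0_le)
      show "(\<lambda>n. (1 / 4 :: real) ^ (n div 2)) \<longlonglongrightarrow> 0"
      proof (rule filterlim_compose[of "\<lambda>n. (1 / 4 :: real) ^ n"])
        show "(\<lambda>n. (1 / 4 :: real) ^ n) \<longlonglongrightarrow> 0"
          by (rule LIMSEQ_realpow_zero) auto
        show "filterlim (\<lambda>n::nat. n div 2) sequentially sequentially"
          by (rule filterlim_at_top_div_const_nat) simp
      qed
      have "norm (cfrac (map a [0..<n]) - X 0) \<le> (1 / 4) ^ (n div 2)" for n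
        using cfrac_approx[of a X 0 n, unfolded add_0] X ap unfolding real_norm_def
        by (meson less_imp_le)
      then show "\<forall>\<^sub>F n in sequentially.
          norm (cfrac (map a [0..<n]) - X 0) \<le> norm ((1 / 4 :: real) ^ (n div 2)) * 1"
        by simp
    qed
    then have "(\<lambda>n. cfrac (map a [0..<n])) \<longlonglongrightarrow> X 0" by (rule LIM_zero_cancel)
    moreover have "X 0 = x" by (simp add: X_def)
    ultimately have "cfrac_infinite x a"
      using ap unfolding cfrac_infinite_def by metis
    then show ?thesis by (auto simp: qm_value_def)
  qed
qed

lemma ex1_qm_value: "0 \<le> x \<Longrightarrow> x \<le> 1 \<Longrightarrow> \<exists>!y. qm_value x y"
  using ex_qm_value qm_value_unique by blast

lemma question_mark_eqI:
  assumes "qm_value x y" shows "question_mark x = y"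
proof (cases "x = 0")
  case True
  then show ?thesis using assms qm_value_0 by (simp add: question_mark_def)
next
  case False
  then show ?thesis using assms qm_value_unique by (auto simp: question_mark_def)
qed

end

theory Submission
  imports Defs "HOL-Real_Asymp.Real_Asymp"
begin

text \<open>The inequality even holds with \<open>E = 0\<close>. The reason is that \<open>?\<close> is very flat at rational
  points, whereas at the smallest fixed point \<open>x\<close> it is not flat from the left: since
  \<open>?(y) < y\<close> for small \<open>y > 0\<close>, the intermediate value argument \<open>ex_fixed_point_between\<close> gives
  \<open>?(y) \<le> y\<close> on \<open>[0, x]\<close>, that is, \<open>?(x) - ?(y) \<ge> x - y\<close>. Symmetrically,
  \<open>?(y) - ?(x) \<ge> y - x\<close> on \<open>[x, 1/2]\<close> if \<open>x\<close> is the greatest fixed point.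

  The flatness is quantified with Farey intervals. Let the reduced fraction \<open>p/q\<close> in \<open>(0, 1/2)\<close> be
  the mediant of the Farey interval \<open>[a/b, c/d]\<close>, whose image under \<open>?\<close> has length \<open>2^-n\<close>. The
  points \<open>w\<^sub>j = (a + j p)/(b + j q)\<close> and \<open>z\<^sub>j = (c + j p)/(d + j q)\<close> approach \<open>p/q\<close> from the left
  and from the right at distance at least \<open>1/(q\<^sup>2 (j + 1))\<close>, while by \<open>question_mark_mediant\<close> their
  values under \<open>?\<close> differ from \<open>?(p/q)\<close> by exactly \<open>2^-(n + 1 + j)\<close>. Suppose that \<open>x\<close> lies strictly
  between \<open>w\<^bsub>k+1\<^esub>\<close> and \<open>z\<^bsub>k+1\<^esub>\<close>. Comparing \<open>x\<close> with \<open>y = w\<^sub>k\<close>, or with \<open>y = z\<^sub>k\<close> for the greatest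
  fixed point, yields \<open>1/(q\<^sup>2 (k + 2)\<^sup>2) \<le> 2^-(n + k)\<close>. So as soon as \<open>q\<^sup>2 (k + 2)\<^sup>2 < 2^(n + k)\<close>,
  the distance of \<open>x\<close> from \<open>p/q\<close> is at least \<open>1/(q\<^sup>2 (k + 2))\<close>; this is
  \<open>fixed_point_separation\<close>, and it includes the irrationality of \<open>x\<close>.

  Finally \<open>q \<le> \<phi>^(n + 2)\<close> for the golden ratio \<open>\<phi>\<close>, hence \<open>n \<ge> log\<^sub>\<phi> q - 2\<close>, and the condition on
  \<open>k\<close> holds once \<open>k - 2 log\<^sub>2 (k + 2) > (2 - log\<^sub>\<phi> 2) log\<^sub>2 q + 2\<close>. The leading coefficient
  satisfies \<open>2 - log\<^sub>\<phi> 2 = \<kappa>\<^sub>1 log\<^sub>\<phi> 2 < 2 \<kappa>\<^sub>1\<close>, so for large \<open>q\<close> there is room for such a \<open>k\<close> with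
  \<open>k + 2 < 2 \<kappa>\<^sub>1 log\<^sub>2 q\<close>.\<close>

section \<open>The functional equation of the question mark function\<close>

lemma qm_value_question_mark:
  assumes "0 \<le> x" "x \<le> 1"
  shows "qm_value x (question_mark x)"
  using ex_qm_value[OF assms] question_mark_eqI by auto

lemma question_mark_bounds:
  assumes "0 \<le> x" "x \<le> 1"
  shows "0 \<le> question_mark x" "question_mark x \<le> 1"
  using qm_value_bounds[OF qm_value_question_mark[OF assms]] by auto

lemma question_mark_0 [simp]: "question_mark 0 = 0"
  by (simp add: question_mark_def)

lemma question_mark_1 [simp]: "question_mark 1 = 1"
  using qm_value_1 qm_value_question_mark[of 1] by simp

lemma question_mark_recip:
  assumes "a > 0" "0 \<le> t" "t \<le> 1"
  shows "question_mark (1 / (real a + t)) = (2 - question_mark t) / 2 ^ a"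
proof -
  have le1: "0 < 1 / (real a + t)" "1 / (real a + t) \<le> 1"
    using assms by (auto simp: divide_simps)
  obtain b :: nat and s y where b: "b > 0" "1 / (real a + t) = 1 / (real b + s)" "qm_value s y"
    "question_mark (1 / (real a + t)) = (2 - y) / 2 ^ b"
    using qm_value_step[OF qm_value_question_mark[of "1 / (real a + t)"]] le1 by auto
  have s: "0 \<le> s" "s \<le> 1" using qm_value_bounds[OF b(3)] by auto
  have y: "y = question_mark s" using question_mark_eqI[OF b(3)] by simp
  have eq: "real a + t = real b + s"
    using b(2) by (metis inverse_eq_divide inverse_inverse_eq)
  \<comment> \<open>The digit is determined by the number, up to the two expansions \<open>a + 1 = (a + 1) + 0\<close>.\<close>
  have "real a \<le> real b + 1" "real b \<le> real a + 1" using eq s assms by linarith+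
  then have "a = b \<or> b = Suc a \<or> a = Suc b" by linarith
  then consider "a = b" "s = t" | "b = Suc a" "s = 0" "t = 1" | "a = Suc b" "s = 1" "t = 0"
    using eq s assms by fastforce
  then show ?thesis
    unfolding b(4) y by cases auto
qed

lemma unit_interval_recip:
  fixes x :: real
  assumes "0 < x" "x \<le> 1"
  obtains a :: nat and t where "a > 0" "0 \<le> t" "t < 1" "x = 1 / (real a + t)"
proof
  have "\<lfloor>1 / x\<rfloor> \<ge> 1" using assms by (simp add: le_floor_iff)
  moreover from this have "real (nat \<lfloor>1 / x\<rfloor>) = of_int \<lfloor>1 / x\<rfloor>" by (intro of_nat_nat) linarith
  ultimately show "nat \<lfloor>1 / x\<rfloor> > 0" "x = 1 / (real (nat \<lfloor>1 / x\<rfloor>) + frac (1 / x))"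
    by (auto simp: frac_def)
qed (use frac_lt_1 in auto)

text \<open>Splitting off one partial quotient halves a possible violation of monotonicity, which
  therefore is smaller than every power of \<open>1 / 2\<close>.\<close>

lemma question_mark_mono:
  assumes "0 \<le> x" "x \<le> y" "y \<le> 1"
  shows "question_mark x \<le> question_mark y"
proof -
  have approx: "question_mark x - question_mark y \<le> (1 / 2) ^ n"
    if "0 \<le> x" "x \<le> y" "y \<le> 1" for n x y
    using that
  proof (induction n arbitrary: x y)
    case 0
    then show ?case using question_mark_bounds[of x] question_mark_bounds[of y] by simp
  next
    case (Suc n)
    show ?case
    proof (cases "x = 0")
      case True
      have "0 \<le> (1 / 2 :: real) ^ Suc n" by simp
      moreover have "0 \<le> question_mark y" using Suc.prems by (intro question_mark_bounds) auto
      moreover have "question_mark x = 0" using True by simp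
      ultimately show ?thesis by linarith
    next
      case False
      then have "0 < x" "x \<le> 1" "0 < y" "y \<le> 1" using Suc.prems by auto
      then obtain a b :: nat and s t where a: "a > 0" "0 \<le> s" "s < 1" "x = 1 / (real a + s)"
        and b: "b > 0" "0 \<le> t" "t < 1" "y = 1 / (real b + t)"
        using unit_interval_recip by metis
      have pos: "real a + s > 0" "real b + t > 0" using a b by auto
      have ge: "real a + s \<ge> real b + t"
        using \<open>x \<le> y\<close> pos a b by (simp add: field_simps)
      have x: "question_mark x = (2 - question_mark s) / 2 ^ a"
        and y: "question_mark y = (2 - question_mark t) / 2 ^ b"
        using a b question_mark_recip by auto
      have "a \<ge> b" using ge a b by linarith
      then consider "a = b" | "a \<ge> Suc b" by linarith
      then show ?thesis
      proof cases
        case 1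
        then have "t \<le> s" using ge by simp
        then have IH: "question_mark t - question_mark s \<le> (1 / 2) ^ n"
          using Suc.IH[of t s] a b by simp
        have "(2::real) ^ 1 \<le> 2 ^ a" using a by (intro power_increasing) auto
        then have "(1 / 2) ^ n / 2 ^ a \<le> (1 / 2 :: real) ^ n / 2" by (intro divide_left_mono) auto
        moreover have "question_mark x - question_mark y = (question_mark t - question_mark s) / 2 ^ a"
          using x y 1 by (simp add: field_simps)
        moreover have "\<dots> \<le> (1 / 2) ^ n / 2 ^ a" using IH by (intro divide_right_mono) auto
        ultimately show ?thesis unfolding power_Suc by linarith
      next
        case 2
        have "question_mark x \<le> 2 / 2 ^ a"
          unfolding x using a question_mark_bounds[of s] by (intro divide_right_mono) auto
        also have "(2::real) / 2 ^ a \<le> 2 / 2 ^ Suc b"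
          using 2 by (intro divide_left_mono power_increasing) auto
        also have "\<dots> = 1 / 2 ^ b" by simp
        also have "\<dots> \<le> question_mark y"
          unfolding y using b question_mark_bounds[of t] by (intro divide_right_mono) auto
        finally have "question_mark x \<le> question_mark y" .
        moreover have "0 \<le> (1 / 2 :: real) ^ Suc n" by simp
        ultimately show ?thesis by linarith
      qed
    qed
  qed
  show ?thesis
  proof (rule ccontr)
    assume "\<not> ?thesis"
    then obtain n where "(1 / 2) ^ n < question_mark x - question_mark y"
      using real_arch_pow_inv[of "question_mark x - question_mark y" "1 / 2"] by auto
    with approx[OF assms, of n] show False by simp
  qed
qed

text \<open>Conway's rule: on a Farey pair the question mark function takes the mediant to the
  arithmetic mean. If \<open>a > 0\<close> and \<open>n = d div c\<close>, the map \<open>x \<mapsto> 1 / x - n\<close> carries the Farey pair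
  \<open>a/b < c/d\<close> to a Farey pair with smaller denominators, so the functional equation gives the rule
  by induction.\<close>

lemma question_mark_mediant:
  fixes a b c d :: nat
  assumes "b * c = a * d + 1" "c \<le> d"
  shows "question_mark (real (a + c) / real (b + d)) =
    (question_mark (real a / real b) + question_mark (real c / real d)) / 2"
  using assms
proof (induction "b + d" arbitrary: a b c d rule: less_induct)
  case less
  have "c > 0" "b > 0" using less.prems(1) by (auto intro: gr0I)
  then have "d > 0" using less.prems(2) by simp
  show ?case
  proof (cases "a = 0")
    case True
    then have "b = 1" "c = 1" using less.prems(1) by auto
    moreover have "question_mark (1 / (real d + 1)) = 1 / 2 ^ d"
      using question_mark_recip[of d 1] \<open>d > 0\<close> by simp
    moreover have "question_mark (1 / real d) = 2 / 2 ^ d"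
      using question_mark_recip[of d 0] \<open>d > 0\<close> by simp
    ultimately show ?thesis using True by (simp add: add.commute)
  next
    case False
    define n r where "n = d div c" and "r = d mod c"
    have d: "d = n * c + r" by (simp add: n_def r_def)
    have "r < c" using \<open>c > 0\<close> by (simp add: n_def r_def)
    have "n > 0" using less.prems(2) \<open>c > 0\<close> by (simp add: n_def r_def div_greater_zero_iff)
    have bc: "b * c = n * a * c + (a * r + 1)"
      using less.prems(1) unfolding d by (simp add: algebra_simps)
    then have "n * a * c \<le> b * c" by simp
    then have "n * a \<le> b" using \<open>c > 0\<close> by simp
    then obtain s where b: "b = n * a + s" using le_Suc_ex by blast
    have sc: "c * s = r * a + 1" using bc unfolding b by (simp add: algebra_simps)
    then have "s > 0" by (auto intro: gr0I)
    have "c * s \<le> c * a"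
    proof -
      have "(r + 1) * a \<le> c * a" using \<open>r < c\<close> by (intro mult_le_mono) auto
      then show ?thesis using sc False by simp
    qed
    then have "s \<le> a" using \<open>c > 0\<close> by simp
    have "1 * a \<le> n * a" using \<open>n > 0\<close> by (intro mult_le_mono) auto
    then have "a < b" using b \<open>s > 0\<close> by linarith
    then have IH: "question_mark (real (r + s) / real (c + a)) =
        (question_mark (real r / real c) + question_mark (real s / real a)) / 2"
      using less.prems(2) sc \<open>s \<le> a\<close> by (intro less.hyps) auto
    have inv: "question_mark (real u / real (n * u + v)) = (2 - question_mark (real v / real u)) / 2 ^ n"
      if "u > 0" "v \<le> u" for u v :: nat
    proof -
      have "real u / real (n * u + v) = 1 / (real n + real v / real u)"
        using that \<open>n > 0\<close> by (simp add: field_simps)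
      then show ?thesis using question_mark_recip[of n "real v / real u"] that \<open>n > 0\<close> by simp
    qed
    have bd: "b + d = n * (a + c) + (r + s)" unfolding b d by (simp add: algebra_simps)
    have e1: "question_mark (real (a + c) / real (b + d)) =
        (2 - question_mark (real (r + s) / real (c + a))) / 2 ^ n"
      unfolding bd using inv[of "a + c" "r + s"] \<open>r < c\<close> \<open>s \<le> a\<close> \<open>c > 0\<close> by (simp add: add_ac)
    have e2: "question_mark (real a / real b) = (2 - question_mark (real s / real a)) / 2 ^ n"
      unfolding b using inv[of a s] False \<open>s \<le> a\<close> by simp
    have e3: "question_mark (real c / real d) = (2 - question_mark (real r / real c)) / 2 ^ n"
      unfolding d using inv[of c r] \<open>r < c\<close> by simp
    show ?thesis unfolding e1 e2 e3 IH by (simp add: field_simps)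
  qed
qed

section \<open>Farey intervals in the left half of the unit interval\<close>

text \<open>\<open>farey_interval n a b c d\<close> says that \<open>[a/b, c/d]\<close> arises from \<open>[0, 1/2]\<close> by \<open>n - 1\<close> steps,
  each of which cuts the interval at its mediant and keeps one of the parts. The depth starts at
  \<open>1\<close> so that the image under the question mark function has length \<open>1 / 2 ^ n\<close>.\<close>

inductive farey_interval :: "nat \<Rightarrow> nat \<Rightarrow> nat \<Rightarrow> nat \<Rightarrow> nat \<Rightarrow> bool" where
  half: "farey_interval 1 0 1 1 2"
| left: "farey_interval n a b c d \<Longrightarrow> farey_interval (Suc n) a b (a + c) (b + d)"
| right: "farey_interval n a b c d \<Longrightarrow> farey_interval (Suc n) (a + c) (b + d) c d"

lemma farey_interval_arith:
  assumes "farey_interval n a b c d"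
  shows "b * c = a * d + 1" "2 * c \<le> d" "2 * a \<le> b" "b > 0" "d > 0"
  using assms by (induction) (auto simp: algebra_simps)

lemma farey_interval_order:
  assumes "farey_interval n a b c d"
  shows "0 \<le> real a / real b" "real a / real b \<le> 1 / 2"
    "real c / real d \<le> 1 / 2" "real c / real d = real a / real b + 1 / (real b * real d)"
proof -
  note A = farey_interval_arith[OF assms]
  have "real b * real c = real a * real d + 1"
    using A(1) by (metis of_nat_1 of_nat_add of_nat_mult)
  then show "real c / real d = real a / real b + 1 / (real b * real d)"
    using A by (simp add: field_simps)
qed (use farey_interval_arith[OF assms] in \<open>auto simp: field_simps simp flip: of_nat_mult\<close>)

lemma question_mark_half [simp]: "question_mark (1 / 2) = 1 / 2"
  using question_mark_recip[of 2 0] by simp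

lemma question_mark_farey_interval:
  assumes "farey_interval n a b c d"
  shows "question_mark (real c / real d) = question_mark (real a / real b) + 1 / 2 ^ n"
  using assms
proof induction
  case (left n a b c d)
  with question_mark_mediant[of b c a d] farey_interval_arith[OF left.hyps]
  show ?case by (simp add: field_simps)
next
  case (right n a b c d)
  with question_mark_mediant[of b c a d] farey_interval_arith[OF right.hyps]
  show ?case by (simp add: field_simps)
qed simp

text \<open>The golden ratio.\<close>

definition golden :: real where "golden = (sqrt 5 + 1) / 2"

lemma golden_square: "golden ^ 2 = golden + 1"
  by (simp add: golden_def power2_eq_square field_simps)

lemma golden_gt: "golden > 3 / 2"
proof -
  have "sqrt 5 > 2" by (rule real_less_rsqrt) simp
  then show ?thesis by (simp add: golden_def)
qed

text \<open>Denominators grow at most like Fibonacci numbers.\<close>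

lemma farey_interval_denominators:
  assumes "farey_interval n a b c d"
  shows "real (b + d) \<le> golden ^ (n + 2)"
proof -
  have step: "golden ^ (m + 2) = golden ^ Suc m + golden ^ m" for m
    using golden_square by (simp only: power_add golden_square) (simp add: algebra_simps)
  have "real b \<le> golden ^ Suc n \<and> real d \<le> golden ^ Suc n \<and> real (b + d) \<le> golden ^ (n + 2)"
    using assms
  proof induction
    case half
    have "golden ^ 3 = golden * golden ^ 2" by (simp add: power3_eq_cube power2_eq_square)
    also have "\<dots> = golden ^ 2 + golden"
      by (subst golden_square) (simp add: power2_eq_square distrib_left)
    also have "\<dots> = 2 * golden + 1" unfolding golden_square by simp
    finally have "golden ^ (1 + 2) = 2 * golden + 1" by (simp add: numeral_3_eq_3)
    moreover have "golden ^ Suc 1 = golden + 1" using golden_square by (simp add: numeral_2_eq_2)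
    ultimately show ?case using golden_gt by simp
  next
    case (left n a b c d)
    have "golden ^ Suc n \<le> golden ^ Suc (Suc n)" using golden_gt by (intro power_increasing) auto
    with left.IH step[of "Suc n"] show ?case by auto
  next
    case (right n a b c d)
    have "golden ^ Suc n \<le> golden ^ Suc (Suc n)" using golden_gt by (intro power_increasing) auto
    with right.IH step[of "Suc n"] show ?case by auto
  qed
  then show ?thesis by simp
qed

text \<open>A fraction inside \<open>[a/b, c/d]\<close> is \<open>(i a + j c)/(i b + j d)\<close> for positive \<open>i\<close> and \<open>j\<close>. Passing to
  the half that contains it subtracts the smaller of \<open>i\<close>, \<open>j\<close> from the larger, as in Euclid's
  algorithm, until \<open>i = j = 1\<close>.\<close>

lemma farey_interval_descent:
  assumes "farey_interval n a b c d" "coprime i j" "i > 0" "j > 0"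
  shows "\<exists>n' a' b' c' d'. farey_interval n' a' b' c' d' \<and>
    i * a + j * c = a' + c' \<and> i * b + j * d = b' + d'"
  using assms
proof (induction "i + j" arbitrary: n a b c d i j rule: less_induct)
  case less
  consider "i = j" | "i < j" | "j < i" by linarith
  then show ?case
  proof cases
    case 1
    then have "i = 1" "j = 1" using less.prems(2) by auto
    then show ?thesis using less.prems(1)
      by (intro exI[of _ n] exI[of _ a] exI[of _ b] exI[of _ c] exI[of _ d]) auto
  next
    case 2
    then obtain k where j: "j = i + k" "k > 0" using less_imp_add_positive by blast
    then have "coprime i k" using less.prems(2) by (simp add: coprime_iff_gcd_eq_1)
    with j less.prems less.hyps[OF _ farey_interval.right[OF less.prems(1)], of i k]
    show ?thesis by (simp add: algebra_simps)
  next
    case 3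
    then obtain k where i: "i = k + j" "k > 0"
      using less_imp_add_positive by (metis add.commute)
    then have "coprime k j" using less.prems(2) by (simp add: coprime_iff_gcd_eq_1)
    with i less.prems less.hyps[OF _ farey_interval.left[OF less.prems(1)], of k j]
    show ?thesis by (simp add: algebra_simps)
  qed
qed

lemma ex_farey_parents:
  assumes "coprime p q" "p > 0" "2 * p < q"
  obtains n a b c d where "farey_interval n a b c d" "p = a + c" "q = b + d"
proof -
  have "coprime (q - 2 * p) p"
  proof -
    have "gcd p (q - 2 * p) = gcd p (q - 2 * p + 2 * p)"
      by (metis gcd_add_mult add.commute)
    then show ?thesis using assms by (simp add: coprime_iff_gcd_eq_1 gcd.commute)
  qed
  from farey_interval_descent[OF farey_interval.half this] assms show ?thesis
    by (auto simp: algebra_simps intro: that)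
qed

lemma farey_interval_left_iterate:
  assumes "farey_interval n a b c d"
  shows "farey_interval (n + k) a b (c + k * a) (d + k * b)"
proof (induction k)
  case (Suc k)
  from farey_interval.left[OF this] show ?case by (simp add: add_ac)
qed (use assms in simp)

lemma farey_interval_right_iterate:
  assumes "farey_interval n a b c d"
  shows "farey_interval (n + k) (a + k * c) (b + k * d) c d"
proof (induction k)
  case (Suc k)
  from farey_interval.right[OF this] show ?case by (simp add: add_ac)
qed (use assms in simp)

section \<open>Fixed points\<close>

text \<open>All dyadic rationals of \<open>[0, 1/2]\<close> are values of the question mark function.\<close>

lemma dyadic_in_range:
  assumes "i \<le> 2 ^ n"
  shows "\<exists>u. 0 \<le> u \<and> u \<le> 1 / 2 \<and> question_mark u = real i / 2 ^ Suc n"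
proof -
  have ex: "\<exists>a b c d. farey_interval (Suc n) a b c d \<and> question_mark (real a / real b) = real i / 2 ^ Suc n"
    if "i < 2 ^ n" for i
    using that
  proof (induction n arbitrary: i)
    case 0
    then show ?case using farey_interval.half by (intro exI[of _ 0] exI[of _ 1] exI[of _ 1] exI[of _ 2]) auto
  next
    case (Suc n)
    then have "i div 2 < 2 ^ n" by auto
    from Suc.IH[OF this] obtain a b c d where F: "farey_interval (Suc n) a b c d"
      and v: "question_mark (real a / real b) = real (i div 2) / 2 ^ Suc n" by blast
    show ?case
    proof (cases "even i")
      case True
      then have "question_mark (real a / real b) = real i / 2 ^ Suc (Suc n)"
        using v by (auto elim!: evenE)
      then show ?thesis using farey_interval.left[OF F] by blast
    next
      case False
      then have "i = 2 * (i div 2) + 1" by simp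
      then have i: "real i = 2 * real (i div 2) + 1"
        by (metis of_nat_1 of_nat_add of_nat_mult of_nat_numeral)
      have "question_mark (real (a + c) / real (b + d)) = real (i div 2) / 2 ^ Suc n + 1 / 2 ^ Suc (Suc n)"
        using question_mark_farey_interval[OF farey_interval.left[OF F]] v by simp
      also have "\<dots> = real i / 2 ^ Suc (Suc n)" unfolding i by (simp add: field_simps)
      finally show ?thesis using farey_interval.right[OF F] by blast
    qed
  qed
  show ?thesis
  proof (cases "i = 2 ^ n")
    case True
    then show ?thesis by (intro exI[of _ "1 / 2"]) simp
  next
    case False
    then obtain a b c d where "farey_interval (Suc n) a b c d"
      "question_mark (real a / real b) = real i / 2 ^ Suc n" using ex[of i] assms by auto
    then show ?thesis using farey_interval_order by blast
  qed
qed

lemma dense_range: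
  fixes u v :: real
  assumes "0 \<le> u" "u < v" "v \<le> 1 / 2"
  shows "\<exists>w. 0 \<le> w \<and> w \<le> 1 / 2 \<and> u < question_mark w \<and> question_mark w < v"
proof -
  obtain n where n: "(1 / 2) ^ n < v - u"
    using real_arch_pow_inv[of "v - u" "1 / 2"] assms by auto
  define N :: real where "N = 2 ^ Suc n"
  have N: "N > 0" "2 / N = (1 / 2) ^ n" by (simp_all add: N_def power_divide)
  define i where "i = nat \<lfloor>u * N\<rfloor> + 1"
  have "\<lfloor>u * N\<rfloor> \<ge> 0" using assms N by simp
  then have i: "real i = of_int \<lfloor>u * N\<rfloor> + 1" by (simp add: i_def)
  have lo: "u * N < real i" unfolding i by linarith
  have "real i \<le> u * N + 1" unfolding i by linarith
  also have "\<dots> < (u + 2 / N) * N" using N by (simp add: field_simps)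
  also have "\<dots> < v * N" using n N by (intro mult_strict_right_mono) auto
  finally have hi: "real i < v * N" .
  also have "v * N \<le> 1 / 2 * N" using assms N by (intro mult_right_mono) auto
  finally have "real i < real (2 ^ n)" by (simp add: N_def)
  then have "i \<le> 2 ^ n" by linarith
  from dyadic_in_range[OF this] obtain w where "0 \<le> w" "w \<le> 1 / 2" "question_mark w = real i / N"
    by (auto simp: N_def)
  moreover have "u < real i / N" "real i / N < v" using lo hi N by (simp_all add: field_simps)
  ultimately show ?thesis by auto
qed

text \<open>An intermediate value argument: a nondecreasing function with dense range has no jumps.\<close>

lemma ex_fixed_point_between:
  assumes "0 < l" "l < r" "r < 1 / 2" "question_mark l < l" "question_mark r > r"
  shows "\<exists>s\<in>qm_fixed_points. l \<le> s \<and> s \<le> r"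
proof -
  define S where "S = {z\<in>{l..r}. question_mark z < z}"
  define s where "s = Sup S"
  have "l \<in> S" using assms by (simp add: S_def)
  have bdd: "bdd_above S" by (rule bdd_aboveI[of _ r]) (simp add: S_def)
  have "l \<le> s" unfolding s_def using \<open>l \<in> S\<close> bdd by (rule cSup_upper)
  have "s \<le> r" unfolding s_def using \<open>l \<in> S\<close> by (intro cSup_least) (auto simp: S_def)
  have below: "question_mark u \<le> s" if "0 \<le> u" "u < s" for u
  proof -
    obtain z where z: "z \<in> S" "u < z" using \<open>u < s\<close> less_cSup_iff[OF _ bdd] \<open>l \<in> S\<close> unfolding s_def by blast
    then have "question_mark u \<le> question_mark z"
      using that assms by (intro question_mark_mono) (auto simp: S_def)
    also have "\<dots> < z" using z by (simp add: S_def)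
    also have "z \<le> s" unfolding s_def using z bdd by (intro cSup_upper)
    finally show ?thesis by simp
  qed
  have above: "question_mark u > s" if "s < u" "u \<le> 1 / 2" for u
  proof (cases "u \<le> r")
    case True
    have "u \<notin> S" using that cSup_upper[OF _ bdd] unfolding s_def by (meson leD)
    then have "question_mark u \<ge> u" using that True \<open>l \<le> s\<close> by (auto simp: S_def)
    then show ?thesis using that by simp
  next
    case False
    then have "question_mark r \<le> question_mark u" using assms that by (intro question_mark_mono) auto
    then show ?thesis using assms \<open>s \<le> r\<close> by simp
  qed
  have s01: "0 \<le> s" "s \<le> 1 / 2" "s < 1 / 2" using \<open>l \<le> s\<close> \<open>s \<le> r\<close> assms by auto
  have qs: "0 \<le> question_mark s" "question_mark s \<le> 1 / 2"
    using question_mark_mono[of s "1 / 2"] question_mark_bounds[of s] s01 by auto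
  have "question_mark s = s"
  proof (rule ccontr)
    assume "question_mark s \<noteq> s"
    then consider "question_mark s < s" | "s < question_mark s" by linarith
    then show False
    proof cases
      case 1
      then obtain w where w: "0 \<le> w" "w \<le> 1 / 2" "question_mark s < question_mark w" "question_mark w < s"
        using dense_range[of "question_mark s" s] qs s01 by auto
      have "w > s" using question_mark_mono[of w s] w s01 by force
      then show False using above[of w] w by simp
    next
      case 2
      then obtain w where w: "0 \<le> w" "w \<le> 1 / 2" "s < question_mark w" "question_mark w < question_mark s"
        using dense_range[of s "question_mark s"] qs s01 by auto
      have "w < s" using question_mark_mono[of s w] w s01 by force
      then show False using below[of w] w by simp
    qed
  qed
  then show ?thesis
    using \<open>l \<le> s\<close> \<open>s \<le> r\<close> assms by (intro bexI[of _ s]) (auto simp: qm_fixed_points_def)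
qed

lemma question_mark_below_near_0:
  assumes "e > 0"
  shows "\<exists>l>0. l < e \<and> question_mark l < l"
proof -
  have "\<forall>\<^sub>F k::nat in sequentially. 1 / (real k + 2) < e"
    using assms by real_asymp
  moreover have "\<forall>\<^sub>F k::nat in sequentially. 1 / 2 ^ (k + 1) < 1 / (real k + 2)"
    by real_asymp
  ultimately have "\<forall>\<^sub>F k::nat in sequentially.
      1 / (real k + 2) < e \<and> 1 / 2 ^ (k + 1) < 1 / (real k + 2)"
    by eventually_elim simp
  then obtain k :: nat where k: "1 / (real k + 2) < e" "1 / 2 ^ (k + 1) < 1 / (real k + 2)"
    using eventually_happens'[OF sequentially_bot] by blast
  have "question_mark (1 / (real k + 2)) = 1 / 2 ^ (k + 1)"
    using question_mark_farey_interval[OF farey_interval_left_iterate[OF farey_interval.half, of k]]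
    by (simp add: add.commute)
  then show ?thesis using k by (intro exI[of _ "1 / (real k + 2)"]) auto
qed

lemma question_mark_above_near_half:
  assumes "e < 1 / 2"
  shows "\<exists>r<1/2. e < r \<and> question_mark r > r"
proof -
  have "\<forall>\<^sub>F k::nat in sequentially. real k / (2 * real k + 1) > e"
    using assms by real_asymp
  moreover have "\<forall>\<^sub>F k::nat in sequentially. 1 / 2 ^ (k + 1) < 1 / 2 - real k / (2 * real k + 1)"
    by real_asymp
  ultimately have "\<forall>\<^sub>F k::nat in sequentially. real k / (2 * real k + 1) > e \<and>
      1 / 2 ^ (k + 1) < 1 / 2 - real k / (2 * real k + 1)"
    by eventually_elim simp
  then obtain k :: nat where k: "real k / (2 * real k + 1) > e"
    "1 / 2 ^ (k + 1) < 1 / 2 - real k / (2 * real k + 1)"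
    using eventually_happens'[OF sequentially_bot] by blast
  have "question_mark (real k / (2 * real k + 1)) = 1 / 2 - 1 / 2 ^ (k + 1)"
    using question_mark_farey_interval[OF farey_interval_right_iterate[OF farey_interval.half, of k]]
    by (simp add: algebra_simps)
  moreover have "1 / (2::real) ^ (k + 1) > 0" by simp
  ultimately show ?thesis using k
    by (intro exI[of _ "real k / (2 * real k + 1)"] conjI) linarith+
qed

lemma below_smallest_fixed_point:
  assumes "x \<in> qm_fixed_points" "\<forall>y\<in>qm_fixed_points. x \<le> y" "0 \<le> y" "y \<le> x"
  shows "question_mark y \<le> y"
proof (rule ccontr)
  assume neg: "\<not> ?thesis"
  then have "0 < y" using assms(3) by (cases "y = 0") auto
  have x: "0 < x" "x < 1 / 2" "question_mark x = x" using assms(1) by (auto simp: qm_fixed_points_def)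
  with neg assms have "y < x" by (cases "y = x") auto
  obtain l where "0 < l" "l < y" "question_mark l < l"
    using question_mark_below_near_0[OF \<open>0 < y\<close>] by auto
  then obtain s where "s \<in> qm_fixed_points" "s \<le> y"
    using ex_fixed_point_between[of l y] neg \<open>y < x\<close> x by auto
  then show False using assms(2) \<open>y < x\<close> by fastforce
qed

lemma above_greatest_fixed_point:
  assumes "x \<in> qm_fixed_points" "\<forall>y\<in>qm_fixed_points. y \<le> x" "x \<le> y" "y \<le> 1 / 2"
  shows "y \<le> question_mark y"
proof (rule ccontr)
  assume neg: "\<not> ?thesis"
  then have "y < 1 / 2" using assms(4) by (cases "y = 1 / 2") auto
  have x: "0 < x" "x < 1 / 2" "question_mark x = x" using assms(1) by (auto simp: qm_fixed_points_def)
  with neg assms have "x < y" by (cases "y = x") auto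
  obtain r where "r < 1 / 2" "y < r" "question_mark r > r"
    using question_mark_above_near_half[OF \<open>y < 1 / 2\<close>] by auto
  then obtain s where "s \<in> qm_fixed_points" "y \<le> s"
    using ex_fixed_point_between[of y r] neg \<open>x < y\<close> x by auto
  then show False using assms(2) \<open>x < y\<close> by fastforce
qed

section \<open>Rational approximation of one-sided fixed points\<close>

text \<open>The core estimate. Its only input about \<open>x\<close> is that it is a fixed point next to which the
  graph stays weakly on one side of the diagonal: below it to the left of \<open>x\<close>, or above it to the
  right of \<open>x\<close>.\<close>

lemma fixed_point_separation:
  fixes x :: real
  assumes x: "0 < x" "x < 1 / 2" "question_mark x = x"
    and side: "(\<forall>y. 0 \<le> y \<and> y \<le> x \<longrightarrow> question_mark y \<le> y) \<or>
               (\<forall>y. x \<le> y \<and> y \<le> 1 / 2 \<longrightarrow> y \<le> question_mark y)"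
    and F: "farey_interval n a b c d"
    and p: "p = a + c" and q: "q = b + d"
    and large: "real q ^ 2 * (real k + 2) ^ 2 < 2 ^ (n + k)"
  shows "\<bar>x - real p / real q\<bar> \<ge> 1 / (real q ^ 2 * (real k + 2))"
proof (rule ccontr)
  assume neg: "\<not> ?thesis"
  define w where "w = (\<lambda>j. real (a + j * p) / real (b + j * q))"
  define z where "z = (\<lambda>j. real (c + j * p) / real (d + j * q))"
  have FL: "farey_interval (Suc n + j) (a + j * p) (b + j * q) p q" for j
    using farey_interval_right_iterate[OF farey_interval.left[OF F]] by (simp add: p q)
  have FR: "farey_interval (Suc n + j) p q (c + j * p) (d + j * q)" for j
    using farey_interval_left_iterate[OF farey_interval.right[OF F]] by (simp add: p q)
  have q0: "real q > 0" using farey_interval_arith[OF F] q by simp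
  have b0: "0 < real (b + j * q)" "real (b + j * q) \<le> real q * (real j + 1)" for j
    using farey_interval_arith[OF F] q by (simp_all only: of_nat_0_less_iff) (auto simp: algebra_simps)
  have d0: "0 < real (d + j * q)" "real (d + j * q) \<le> real q * (real j + 1)" for j
    using farey_interval_arith[OF F] q by (simp_all only: of_nat_0_less_iff) (auto simp: algebra_simps)
  have wp: "real p / real q = w j + 1 / (real (b + j * q) * real q)" for j
    using farey_interval_order(4)[OF FL[of j]] by (simp add: w_def)
  have zp: "z j = real p / real q + 1 / (real q * real (d + j * q))" for j
    using farey_interval_order(4)[OF FR[of j]] by (simp add: z_def)
  have gap: "1 / (real q ^ 2 * (real k + 2)) \<le> 1 / (real q * m)"
    if "0 < m" "m \<le> real q * (real (Suc k) + 1)" for m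
  proof (rule divide_left_mono)
    have "real q * m \<le> real q * (real q * (real (Suc k) + 1))" using that q0 by (intro mult_left_mono) auto
    then show "real q * m \<le> real q ^ 2 * (real k + 2)" by (simp add: power2_eq_square algebra_simps)
  qed (use that q0 in auto)
  have xw: "w (Suc k) < x" and xz: "x < z (Suc k)"
    using neg wp[of "Suc k"] zp[of "Suc k"] gap[OF b0[of "Suc k"]] gap[OF d0[of "Suc k"]]
    by (auto simp: mult.commute abs_if split: if_splits)
  \<comment> \<open>Consecutive points are themselves the end points of a Farey interval.\<close>
  have step: "farey_interval (Suc n + Suc k) (a + k * p) (b + k * q) (a + Suc k * p) (b + Suc k * q)"
    "farey_interval (Suc n + Suc k) (c + Suc k * p) (d + Suc k * q) (c + k * p) (d + k * q)"
    using farey_interval.left[OF FL[of k]] farey_interval.right[OF FR[of k]] by (simp_all add: add_ac)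
  have small: "1 / (real q ^ 2 * (real k + 2) ^ 2) \<le> 1 / (m * m')"
    if "0 < m" "m \<le> real q * (real k + 1)" "0 < m'" "m' \<le> real q * (real (Suc k) + 1)" for m m'
  proof (rule divide_left_mono)
    have "m * m' \<le> (real q * (real k + 2)) * (real q * (real k + 2))"
    proof (rule mult_mono)
      have "real q * (real k + 1) \<le> real q * (real k + 2)" using q0 by simp
      then show "m \<le> real q * (real k + 2)" using that by linarith
    qed (use that q0 in \<open>auto simp: algebra_simps\<close>)
    then show "m * m' \<le> real q ^ 2 * (real k + 2) ^ 2" by (simp add: power2_eq_square algebra_simps)
  qed (use that q0 in auto)
  have ww: "w (Suc k) - w k \<ge> 1 / (real q ^ 2 * (real k + 2) ^ 2)"
    using small[OF b0[of k] b0[of "Suc k"]] farey_interval_order(4)[OF step(1)]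
    unfolding w_def by linarith
  have zz: "z k - z (Suc k) \<ge> 1 / (real q ^ 2 * (real k + 2) ^ 2)"
    using small[OF d0[of k] d0[of "Suc k"]] farey_interval_order(4)[OF step(2)]
    unfolding z_def mult.commute[of "real (d + k * q)"] by linarith
  have small_image: "1 / 2 ^ (n + k) < 1 / (real q ^ 2 * (real k + 2) ^ 2)"
    using large q0 by (intro divide_strict_left_mono) auto
  have qp: "question_mark (real p / real q) = question_mark (w j) + 1 / 2 ^ (Suc n + j)"
    "question_mark (z j) = question_mark (real p / real q) + 1 / 2 ^ (Suc n + j)" for j
    using question_mark_farey_interval[OF FL[of j]] question_mark_farey_interval[OF FR[of j]]
    by (simp_all add: w_def z_def)
  define e :: real where "e = 1 / 2 ^ (n + k)"
  have e: "1 / 2 ^ (Suc n + k) = e / 2" "1 / 2 ^ (Suc n + Suc k) = e / 4" "e > 0"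
    by (simp_all add: e_def)
  have image_w: "question_mark (z (Suc k)) = question_mark (w k) + 3 / 4 * e"
    using qp(1)[of k] qp(2)[of "Suc k"] unfolding e by linarith
  have image_z: "question_mark (z k) = question_mark (w (Suc k)) + 3 / 4 * e"
    using qp(2)[of k] qp(1)[of "Suc k"] unfolding e by linarith
  have w01: "0 \<le> w j" "w j \<le> 1 / 2" for j
    using farey_interval_order(1,2)[OF FL[of j]] unfolding w_def by simp_all
  have z01: "0 \<le> z j" "z j \<le> 1 / 2" for j
    using farey_interval_order(3)[OF FR[of j]] unfolding z_def by simp_all
  have z1: "z (Suc k) \<le> 1" using z01(2)[of "Suc k"] by linarith
  have mono: "question_mark (w (Suc k)) \<le> x" "x \<le> question_mark (z (Suc k))"
    using question_mark_mono[of "w (Suc k)" x] question_mark_mono[of x "z (Suc k)"] xw xz w01 z1 x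
    by auto
  from side show False
  proof
    assume "\<forall>y. 0 \<le> y \<and> y \<le> x \<longrightarrow> question_mark y \<le> y"
    moreover have "w k \<le> x" using ww xw small_image e(3) unfolding e_def by linarith
    ultimately have "question_mark (w k) \<le> w k" using w01 by blast
    then show False using ww xw mono image_w small_image e(3) unfolding e_def by linarith
  next
    assume "\<forall>y. x \<le> y \<and> y \<le> 1 / 2 \<longrightarrow> y \<le> question_mark y"
    moreover have "x \<le> z k" using zz xz small_image e(3) unfolding e_def by linarith
    ultimately have "z k \<le> question_mark (z k)" using z01 by blast
    then show False using zz xz mono image_z small_image e(3) unfolding e_def by linarith
  qed
qed

lemma kappa1_eq: "kappa1 = (2 * ln golden - ln 2) / ln 2"
  by (simp add: kappa1_def golden_def log_def diff_divide_distrib)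

text \<open>This is the positivity of \<open>\<kappa>\<^sub>1\<close>, and also \<open>log\<^sub>\<phi> 2 < 2\<close>.\<close>

lemma two_ln_golden: "2 * ln golden > ln 2"
proof -
  have "2 * ln golden = ln (golden ^ 2)" using golden_gt by (simp add: ln_realpow)
  also have "\<dots> > ln 2" unfolding golden_square using golden_gt by (subst ln_less_cancel_iff) auto
  finally show ?thesis .
qed

text \<open>A condition on \<open>k\<close> that is uniform over all denominators \<open>q \<le> Q\<close>: the Fibonacci growth bounds
  the depth \<open>n\<close> from below, and the excess \<open>(2 - ln 2 / ln \<phi>) ln q\<close> is increasing in \<open>q\<close>.\<close>

lemma farey_depth_threshold:
  assumes "farey_interval n a b c d" "q = b + d" "q \<le> Q"
    and k: "2 * ln (real k + 2) + (2 - ln 2 / ln golden) * ln (real Q) + 2 * ln 2 < real k * ln 2"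
  shows "real q ^ 2 * (real k + 2) ^ 2 < 2 ^ (n + k)"
proof -
  have q: "real q > 0" using farey_interval_arith[OF assms(1)] assms(2) by simp
  have G: "ln golden > 0" using golden_gt by simp
  have "real q \<le> golden ^ (n + 2)" using farey_interval_denominators[OF assms(1)] assms(2) by simp
  then have "ln (real q) \<le> ln (golden ^ (n + 2))" using q golden_gt by (subst ln_le_cancel_iff) auto
  also have "\<dots> = (real n + 2) * ln golden" using golden_gt by (subst ln_realpow) auto
  finally have "ln (real q) / ln golden \<le> real n + 2" using G by (simp add: pos_divide_le_eq)
  then have "ln (real q) / ln golden * ln 2 \<le> (real n + 2) * ln 2" by (intro mult_right_mono) auto
  then have n: "ln 2 / ln golden * ln (real q) \<le> (real n + 2) * ln 2" by (simp add: mult.commute)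
  have "ln 2 / ln golden \<le> 2" using two_ln_golden G by (simp add: pos_divide_le_eq)
  then have "(2 - ln 2 / ln golden) * ln (real q) \<le> (2 - ln 2 / ln golden) * ln (real Q)"
    using q assms(3) by (intro mult_left_mono) auto
  then have "2 * ln (real q) + 2 * ln (real k + 2) < (real n + real k) * ln 2"
    using n k by (simp add: algebra_simps)
  moreover have "ln (real q ^ 2 * (real k + 2) ^ 2) = 2 * ln (real q) + 2 * ln (real k + 2)"
    using q by (simp add: ln_mult ln_realpow)
  moreover have "ln ((2::real) ^ (n + k)) = (real n + real k) * ln 2" by (simp add: ln_realpow)
  ultimately have "ln (real q ^ 2 * (real k + 2) ^ 2) < ln (2 ^ (n + k))" by linarith
  then show ?thesis using q by (subst (asm) ln_less_cancel_iff) auto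
qed

text \<open>The parameter \<open>k\<close> is taken just below \<open>X - 2\<close> for \<open>X = 2 \<kappa>\<^sub>1 log\<^sub>2 q\<close>. What remains of the
  threshold condition is \<open>2 log\<^sub>2 X + O(1) < (1 - \<rho>) X\<close> with \<open>\<rho> = ln 2 / (2 ln \<phi>) < 1\<close>.\<close>

lemma eventually_ex_parameter:
  "\<forall>\<^sub>F q::nat in sequentially. \<exists>k::nat. real k + 2 < 2 * kappa1 / ln 2 * ln (real q) \<and>
     2 * ln (real k + 2) + (2 - ln 2 / ln golden) * ln (real q) + 2 * ln 2 < real k * ln 2"
proof -
  define r where "r = 1 - ln 2 / (2 * ln golden)"
  define C where "C = 2 * kappa1 / ln 2"
  have G: "ln golden > 0" using golden_gt by simp
  have r: "r > 0" unfolding r_def using two_ln_golden G by (simp add: divide_simps)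
  have "C > 0" unfolding C_def kappa1_eq using two_ln_golden by simp
  then have lim: "filterlim (\<lambda>q::nat. C * ln (real q)) at_top sequentially" by real_asymp
  have CL: "(2 - ln 2 / ln golden) * y = (1 - r) * ln 2 * (C * y)" for y
    unfolding r_def C_def kappa1_eq using G by (simp add: field_simps power2_eq_square)
  have "\<forall>\<^sub>F X in at_top. 2 * ln X + 6 * ln 2 < r * X * ln (2::real)"
    using r by real_asymp
  then have "\<forall>\<^sub>F X in at_top. 4 < X \<and> 2 * ln X + 6 * ln 2 < r * X * ln (2::real)"
    using eventually_gt_at_top eventually_conj by blast
  from eventually_compose_filterlim[OF this lim]
  show ?thesis
  proof eventually_elim
    case (elim q)
    define X where "X = C * ln (real q)"
    define k where "k = nat (\<lceil>X\<rceil> - 3)"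
    have X: "4 < X" "2 * ln X + 6 * ln 2 < r * X * ln 2" using elim by (auto simp: X_def)
    then have "real k = of_int \<lceil>X\<rceil> - 3" unfolding k_def by (subst of_nat_nat) linarith+
    then have k: "real k + 2 < X" "X - 3 \<le> real k" by linarith+
    have "ln (real k + 2) \<le> ln X" using k by simp
    moreover have "(X - 3) * ln 2 \<le> real k * ln 2" using k by (intro mult_right_mono) auto
    moreover have "(2 - ln 2 / ln golden) * ln (real q) = X * ln 2 - r * X * ln 2"
      unfolding CL X_def by (simp add: algebra_simps)
    moreover have "ln (2::real) > 0" by simp
    ultimately have "2 * ln (real k + 2) + (2 - ln 2 / ln golden) * ln (real q) + 2 * ln 2 < real k * ln 2"
      using X(2) unfolding left_diff_distrib by linarith
    then show ?case using k(1) unfolding X_def C_def by blast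
  qed
qed

theorem theorem3:
  fixes x :: real
  assumes "(x \<in> qm_fixed_points \<and> (\<forall>y\<in>qm_fixed_points. x \<le> y)) \<or>
           (x \<in> qm_fixed_points \<and> (\<forall>y\<in>qm_fixed_points. y \<le> x))"
  shows "\<exists>q0::nat. q0 > 0 \<and> (\<exists>E :: nat \<Rightarrow> real.
           E \<in> O(\<lambda>q. ln (ln (real q))) \<and>
           (\<forall>q p :: nat. q > q0 \<longrightarrow> p > 0 \<longrightarrow>
              \<bar>x - real p / real q\<bar> >
                1 / ((2 * kappa1 / ln 2 * ln (real q) + E q) * (real q)\<^sup>2)))"
proof -
  have x: "0 < x" "x < 1 / 2" "question_mark x = x" using assms by (auto simp: qm_fixed_points_def)
  have side: "(\<forall>y. 0 \<le> y \<and> y \<le> x \<longrightarrow> question_mark y \<le> y) \<or>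
      (\<forall>y. x \<le> y \<and> y \<le> 1 / 2 \<longrightarrow> y \<le> question_mark y)"
    using assms below_smallest_fixed_point above_greatest_fixed_point by blast
  define C where "C = 2 * kappa1 / ln 2"
  have "C > 0" unfolding C_def kappa1_eq using two_ln_golden by simp
  then have "\<forall>\<^sub>F q::nat in sequentially. 1 / (C * ln (real q) * (real q)\<^sup>2) < 1 / 2 - x"
    using x by real_asymp
  then have "\<forall>\<^sub>F q::nat in sequentially. 1 / (C * ln (real q) * (real q)\<^sup>2) < 1 / 2 - x \<and>
     (\<exists>k::nat. real k + 2 < C * ln (real q) \<and>
       2 * ln (real k + 2) + (2 - ln 2 / ln golden) * ln (real q) + 2 * ln 2 < real k * ln 2)"
    using eventually_ex_parameter unfolding C_def by (rule eventually_conj)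
  then obtain N where N: "\<And>q. q \<ge> N \<Longrightarrow> 1 / (C * ln (real q) * (real q)\<^sup>2) < 1 / 2 - x"
    "\<And>q. q \<ge> N \<Longrightarrow> \<exists>k::nat. real k + 2 < C * ln (real q) \<and>
       2 * ln (real k + 2) + (2 - ln 2 / ln golden) * ln (real q) + 2 * ln 2 < real k * ln 2"
    unfolding eventually_sequentially by blast
  have main: "1 / (C * ln (real q) * (real q)\<^sup>2) < \<bar>x - real p / real q\<bar>"
    if "q > Suc N" "p > 0" for p q :: nat
  proof (cases "2 * p < q")
    case False
    then have "1 / 2 \<le> real p / real q" using that by (simp add: field_simps)
    moreover have "1 / (C * ln (real q) * (real q)\<^sup>2) < 1 / 2 - x" using N(1)[of q] that by simp
    ultimately show ?thesis by linarith
  next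
    case True
    have "N \<le> q" using that by simp
    then obtain k :: nat where k: "real k + 2 < C * ln (real q)"
      "2 * ln (real k + 2) + (2 - ln 2 / ln golden) * ln (real q) + 2 * ln 2 < real k * ln 2"
      using N(2) by blast
    \<comment> \<open>The fraction need not be reduced. Since \<open>k\<close> is chosen for \<open>q\<close> and works for all smaller
      denominators, the reduced fraction may have a small denominator.\<close>
    define g where "g = gcd p q"
    define p' q' where "p' = p div g" and "q' = q div g"
    have "g > 0" using that by (simp add: g_def)
    have pq: "p = g * p'" "q = g * q'" by (simp_all add: g_def p'_def q'_def)
    have "coprime p' q'" unfolding p'_def q'_def g_def using that by (intro div_gcd_coprime) auto
    moreover have "p' > 0" "2 * p' < q'" using that True \<open>g > 0\<close> unfolding pq by auto
    ultimately obtain n a b c d where F: "farey_interval n a b c d" "p' = a + c" "q' = b + d"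
      by (rule ex_farey_parents)
    have "q' \<le> q" "q' > 0" using \<open>g > 0\<close> \<open>2 * p' < q'\<close> unfolding pq by auto
    have "1 / (C * ln (real q) * (real q)\<^sup>2) < 1 / (real q ^ 2 * (real k + 2))"
      using k(1) that by (intro divide_strict_left_mono) (auto simp: mult.commute)
    also have "\<dots> \<le> 1 / (real q' ^ 2 * (real k + 2))"
      using \<open>q' \<le> q\<close> \<open>q' > 0\<close> by (intro divide_left_mono mult_right_mono power_mono) auto
    also have "\<dots> \<le> \<bar>x - real p' / real q'\<bar>"
      using fixed_point_separation[OF x side F]
        farey_depth_threshold[OF F(1,3) \<open>q' \<le> q\<close> k(2)] by simp
    also have "real p' / real q' = real p / real q" using \<open>g > 0\<close> unfolding pq by simp
    finally show ?thesis .
  qed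
  show ?thesis
  proof (intro exI[of _ "Suc N"] exI[of _ "\<lambda>_. 0"] conjI allI impI)
    fix q p :: nat
    assume "q > Suc N" "p > 0"
    then show "\<bar>x - real p / real q\<bar> > 1 / ((2 * kappa1 / ln 2 * ln (real q) + 0) * (real q)\<^sup>2)"
      using main[of q p] by (simp add: C_def)
  qed simp_all
qed

end
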